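(* Let $f(x)=x^{e_0}\prod_{d\in\mathcal{D}}\Phi_d(x)^{e_d}$, where $e_0\ge 0$, $\mathcal{D}$ is a finite set of positive integers and $e_d\ge 1$ for $d\in\mathcal{D}$ (equivalently, $f$ is a Kronecker polynomial written in its factorization into irreducibles). (a) If $f(1)\neq 0$, then for every integer $k\ge 2$, \[\sum_{j=1}^k S_2(k,j)\,(\log f)^{(j)}(1)=\frac{B_k^+}{k}\sum_{d\in\mathcal{D}}e_d J_k(d).\] (b) If $f(-1)\neq 0$, then for every integer $k\ge 2$, \[\sum_{j=1}^k (-1)^j S_2(k,j)\,(\log f)^{(j)}(-1)=\frac{B_k^+}{k}\sum_{d\in\mathcal{D}}e_d J_k(d\alpha_d).\]
   Context: $\Phi_d$ denotes the $d$-th cyclotomic polynomial. For a rational function $f$ and $k\ge1$, $(\log f)^{(k)}$ means $(f'/f)^{(k-1)}$ (no logarithm is taken). $S_2(k,j)$ denotes the Stirling number of the second kind, defined by $x^k=\sum_{j=0}^k S_2(k,j)\,x(x-1)\cdots(x-j+1)$. The Bernoulli numbers $B_k^+$ are defined by $\frac{te^t}{e^t-1}=\sum_{k\ge0}B_k^+\frac{t^k}{k!}$ (so $B_1^+=1/2$). $J_k$ is the Jordan totient function, $J_k(n)=n^k\prod_{p\mid n}(1-p^{-k})$. For a positive integer $n$, $\alpha_n=2$ if $n$ is odd, $\alpha_n=1/2$ if $2\mid n$ but $4\nmid n$, and $\alpha_n=1$ if $4\mid n$. *)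

theory Defs
  imports
    "HOL-Analysis.Analysis"
    "HOL-Computational_Algebra.Computational_Algebra"
    "HOL-Combinatorics.Stirling"
begin

definition primitive_roots_of_unity :: "nat \<Rightarrow> complex set" where
  "primitive_roots_of_unity d = {z. z ^ d = 1 \<and> (\<forall>m. 0 < m \<and> m < d \<longrightarrow> z ^ m \<noteq> 1)}"

text \<open>
  The set of primitive roots is finite only for \<open>d > 0\<close>; the value at \<open>d = 0\<close> is meaningless.
\<close>
definition cyclotomic_poly :: "nat \<Rightarrow> complex poly" where
  "cyclotomic_poly d = (\<Prod>z\<in>primitive_roots_of_unity d. [:- z, 1:])"

lemma finite_primitive_roots_of_unity:
  assumes "d > 0"
  shows "finite (primitive_roots_of_unity d)"
proof (rule finite_subset)
  show "primitive_roots_of_unity d \<subseteq> {z. poly (monom 1 d - 1) z = 0}"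
    by (auto simp: primitive_roots_of_unity_def poly_monom)
  have "coeff (monom 1 d - 1 :: complex poly) d = 1"
    using assms by simp
  then have "monom 1 d - 1 \<noteq> (0 :: complex poly)"
    by (metis coeff_0 zero_neq_one)
  then show "finite {z. poly (monom 1 d - 1 :: complex poly) z = 0}"
    by (rule poly_roots_finite)
qed

text \<open>
  \<open>(log f)\<^sup>(\<^sup>k\<^sup>)(x)\<close> for \<open>k \<ge> 1\<close>, as an iterated derivative of \<open>f' / f\<close>.
\<close>
definition log_deriv :: "(complex \<Rightarrow> complex) \<Rightarrow> nat \<Rightarrow> complex \<Rightarrow> complex" where
  "log_deriv f k x = (deriv ^^ (k - 1)) (\<lambda>w. deriv f w / f w) x"

definition bernoulli_plus :: "nat \<Rightarrow> real" where
  "bernoulli_plus k = fact k * fps_nth (fps_X * fps_exp 1 / (fps_exp 1 - 1)) k"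

lemma bernoulli_plus_gen_fun:
  "Abs_fps (\<lambda>k. bernoulli_plus k / fact k) * (fps_exp 1 - 1) = fps_X * fps_exp 1"
proof -
  have "subdegree (fps_exp 1 - 1 :: real fps) = 1"
    by (rule subdegreeI) auto
  then have "(fps_exp 1 - 1 :: real fps) dvd fps_X * fps_exp 1"
    by (subst fps_dvd_iff) auto
  moreover have "Abs_fps (\<lambda>k. bernoulli_plus k / fact k) = fps_X * fps_exp 1 / (fps_exp 1 - 1)"
    by (simp add: fps_eq_iff bernoulli_plus_def)
  ultimately show ?thesis by simp
qed

definition jordan_totient :: "nat \<Rightarrow> nat \<Rightarrow> real" where
  "jordan_totient k n = real n ^ k * (\<Prod>p\<in>prime_factors n. 1 - 1 / real p ^ k)"

definition alpha :: "nat \<Rightarrow> real" where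
  "alpha n = (if odd n then 2 else if \<not> 4 dvd n then 1 / 2 else 1)"

text \<open>
  \<open>n * alpha n\<close> is always a natural number; the coercion is needed only because \<open>alpha\<close> takes
  the value \<open>1 / 2\<close>.
\<close>
definition alpha_scaled :: "nat \<Rightarrow> nat" where
  "alpha_scaled n = nat \<lfloor>real n * alpha n\<rfloor>"

lemma real_alpha_scaled: "real (alpha_scaled n) = real n * alpha n"
proof -
  have "real n * alpha n \<in> \<nat>"
    by (auto simp: alpha_def elim!: evenE)
  then show ?thesis
    by (auto simp: alpha_scaled_def elim!: Nats_cases)
qed

text \<open>
  The library defines \<^const>\<open>Stirling\<close> by its recurrence; this is the equivalent defining expansion
  of a power into falling factorials.
\<close>
lemma power_eq_sum_Stirling:
  fixes x :: "'a :: comm_ring_1"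
  shows "x ^ k = (\<Sum>j\<le>k. of_nat (Stirling k j) * (\<Prod>i<j. x - of_nat i))"
proof (induction k)
  case 0
  show ?case by simp
next
  case (Suc k)
  define F where "F = (\<lambda>j. \<Prod>i<j. x - of_nat i)"
  have F_Suc: "x * F j = F (Suc j) + of_nat j * F j" for j
    by (simp add: F_def algebra_simps)
  have "x ^ Suc k = (\<Sum>j\<le>k. of_nat (Stirling k j) * (x * F j))"
    by (simp add: Suc.IH F_def sum_distrib_left mult_ac)
  also have "\<dots> = (\<Sum>j\<le>k. of_nat (Stirling k j) * F (Suc j))
      + (\<Sum>j\<le>k. of_nat (j * Stirling k j) * F j)"
    by (simp add: F_Suc algebra_simps sum.distrib)
  also have "(\<Sum>j\<le>k. of_nat (j * Stirling k j) * F j)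
      = (\<Sum>j\<le>Suc k. of_nat (j * Stirling k j) * F j)"
    by simp
  also have "\<dots> = (\<Sum>j\<le>k. of_nat (Suc j * Stirling k (Suc j)) * F (Suc j))"
    by (subst sum.atMost_Suc_shift) simp
  also have "(\<Sum>j\<le>k. of_nat (Stirling k j) * F (Suc j)) + \<dots>
      = (\<Sum>j\<le>k. of_nat (Stirling (Suc k) (Suc j)) * F (Suc j))"
    by (simp add: sum.distrib[symmetric] algebra_simps)
  also have "\<dots> = (\<Sum>j\<le>Suc k. of_nat (Stirling (Suc k) j) * F j)"
    by (subst sum.atMost_Suc_shift) simp
  finally show ?case by (simp add: F_def)
qed

end

(*
  Let g(t) = log f(c e^t) with c = 1 or c = -1. Since the Stirling numbers convert derivatives in
  x = c e^t into derivatives in t, the left-hand side is the k-th derivative of g at 0, which is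
  additive in the factors of f; the factor x^e0 only contributes a linear term to g.
  For c = 1, the product of Phi_d over the divisors d > 1 of n becomes (e^(nt) - 1) / (e^t - 1), whose
  logarithmic derivative is the sum of B_k^+ (n^k - 1) t^(k-1) / k!. Since n^k is the sum of J_k(d)
  over the divisors of n, induction on d gives the contribution of each Phi_d.
  The case c = -1 reduces to c = 1, because Phi_d(-x) = Phi_(d alpha_d)(x) up to sign.
*)

theory Submission
  imports Defs "HOL-Complex_Analysis.Complex_Analysis"
begin

section \<open>Jordan's totient function\<close>

lemma jordan_totient_mult_coprime:
  assumes "coprime a b" "a > 0" "b > 0"
  shows "jordan_totient k (a * b) = jordan_totient k a * jordan_totient k b"
proof -
  have "prime_factors (a * b) = prime_factors a \<union> prime_factors b"
    using assms by (simp add: prime_factors_product)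
  moreover have "prime_factors a \<inter> prime_factors b = {}"
    using assms(1) by (auto simp: in_prime_factors_iff dest: coprime_common_divisor)
  ultimately show ?thesis
    by (simp add: jordan_totient_def prod.union_disjoint power_mult_distrib)
qed

lemma jordan_totient_prime_power:
  assumes "prime p"
  shows "jordan_totient k (p ^ Suc i) = real (p ^ Suc i) ^ k - real (p ^ i) ^ k"
proof -
  have "prime_factors (p ^ Suc i) = {p}"
    using assms by (simp add: prime_factorization_prime_power del: power_Suc)
  moreover have "real p > 0"
    using assms prime_gt_0_nat by simp
  ultimately show ?thesis
    by (simp add: jordan_totient_def field_simps power_mult_distrib)
qed

lemma jordan_totient_1 [simp]: "jordan_totient k (Suc 0) = 1"
  by (simp add: jordan_totient_def)

text \<open>The sum telescopes, because \<open>jordan_totient k (p ^ Suc i)\<close> is the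
  difference of consecutive values of \<open>real (p ^ i) ^ k\<close>.\<close>

lemma sum_jordan_totient_prime_power:
  assumes "prime p"
  shows "(\<Sum>d | d dvd p ^ n. jordan_totient k d) = real (p ^ n) ^ k"
proof -
  have "inj_on (\<lambda>i. p ^ i) {..n}"
    using prime_gt_1_nat[OF assms] by (auto simp: inj_on_def)
  moreover have "{d. d dvd p ^ n} = (\<lambda>i. p ^ i) ` {..n}"
    using assms by (auto simp: divides_primepow_nat)
  ultimately have "(\<Sum>d | d dvd p ^ n. jordan_totient k d) = (\<Sum>i\<le>n. jordan_totient k (p ^ i))"
    by (simp add: sum.reindex)
  also have "\<dots> = real (p ^ n) ^ k"
    by (induction n) (simp_all add: jordan_totient_prime_power[OF assms] del: power_Suc)
  finally show ?thesis .
qed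

text \<open>Coprimality makes the factors recoverable from the product: they are its gcds with
  \<open>a\<close> and with \<open>b\<close>.\<close>

lemma bij_betw_divisors_coprime:
  fixes a b :: nat
  assumes "coprime a b"
  shows "bij_betw (\<lambda>(x, y). x * y) ({x. x dvd a} \<times> {y. y dvd b}) {d. d dvd a * b}"
proof -
  have gcd_eq: "gcd (x * y) a = x" "gcd (x * y) b = y" if "x dvd a" "y dvd b" for x y
  proof -
    have "coprime y a" "coprime x b"
      using that assms coprime_divisors[of y b a a] coprime_divisors[of x a b b]
      by (auto simp: coprime_commute)
    then show "gcd (x * y) a = x" "gcd (x * y) b = y"
      using that
      by (simp_all only: gcd_mult_left_left_cancel gcd_mult_left_right_cancel gcd_nat.absorb1 coprime_commute)
  qed
  show ?thesis
  proof (rule bij_betw_imageI)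
    show "inj_on (\<lambda>(x, y). x * y) ({x. x dvd a} \<times> {y. y dvd b})"
    proof (clarsimp simp: inj_on_def)
      fix x y x' y'
      assume "x dvd a" "y dvd b" "x' dvd a" "y' dvd b" "x * y = x' * y'"
      then show "x = x' \<and> y = y'"
        using gcd_eq by metis
    qed
    show "(\<lambda>(x, y). x * y) ` ({x. x dvd a} \<times> {y. y dvd b}) = {d. d dvd a * b}"
    proof (intro equalityI subsetI)
      fix d assume "d \<in> {d. d dvd a * b}"
      then obtain x y where "d = x * y" "x dvd a" "y dvd b"
        using division_decomp by blast
      then show "d \<in> (\<lambda>(x, y). x * y) ` ({x. x dvd a} \<times> {y. y dvd b})"
        by force
    qed (auto intro: mult_dvd_mono)
  qed
qed

text \<open>Strong induction that splits off the full power \<open>q\<close> of a prime dividing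
  \<open>n\<close>. The divisor sum factors over the coprime parts \<open>q\<close> and
  \<open>m\<close>; the first factor is the telescoping sum, the second the induction
  hypothesis.\<close>

lemma sum_jordan_totient:
  assumes "n > 0"
  shows "(\<Sum>d | d dvd n. jordan_totient k d) = real n ^ k"
  using assms
proof (induction n rule: less_induct)
  case (less n)
  show ?case
  proof (cases "n = 1")
    case False
    then obtain p where p: "prime p" "p dvd n"
      using prime_factor_nat by blast
    then obtain m where m: "n = p ^ multiplicity p n * m" "\<not> p dvd m"
      using less.prems multiplicity_decompose'[of n p] not_prime_unit by (metis mult.commute not_gr_zero)
    define q where "q = p ^ multiplicity p n"
    have n: "n = q * m"
      using m(1) by (simp add: q_def)
    have pos: "q > 0" "m > 0"
      using n less.prems by auto
    have cop: "coprime q m"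
      unfolding q_def using p(1) m(2) by (simp add: prime_imp_coprime coprime_power_left_iff)
    have "q > 1"
      unfolding q_def using p less.prems prime_gt_1_nat[OF p(1)]
      by (intro one_less_power) (auto simp: prime_multiplicity_gt_zero_iff)
    then have "m < n"
      using n pos by simp
    have "(\<Sum>d | d dvd n. jordan_totient k d)
        = (\<Sum>(x, y) \<in> {x. x dvd q} \<times> {y. y dvd m}. jordan_totient k (x * y))"
      unfolding n using sum.reindex_bij_betw[OF bij_betw_divisors_coprime[OF cop], of "jordan_totient k"]
      by (simp add: case_prod_unfold)
    also have "\<dots> = (\<Sum>(x, y) \<in> {x. x dvd q} \<times> {y. y dvd m}. jordan_totient k x * jordan_totient k y)"
    proof (intro sum.cong refl, clarify)
      fix x y assume "x dvd q" "y dvd m"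
      then show "jordan_totient k (x * y) = jordan_totient k x * jordan_totient k y"
        using pos cop coprime_divisors
        by (intro jordan_totient_mult_coprime) (auto intro: dvd_pos_nat)
    qed
    also have "\<dots> = (\<Sum>x | x dvd q. jordan_totient k x) * (\<Sum>y | y dvd m. jordan_totient k y)"
      by (simp add: sum_product sum.cartesian_product)
    also have "\<dots> = real n ^ k"
      using sum_jordan_totient_prime_power[OF p(1)] less.IH[OF \<open>m < n\<close> pos(2)]
      by (simp add: q_def[symmetric] n power_mult_distrib) (simp add: q_def)
    finally show ?thesis .
  qed simp
qed


section \<open>Cyclotomic polynomials\<close>

lemma primitive_root_power_eq_1_iff:
  assumes "z \<in> primitive_roots_of_unity d" "d > 0"
  shows "z ^ m = 1 \<longleftrightarrow> d dvd m"
proof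
  assume "z ^ m = 1"
  have z: "z ^ d = 1" "\<And>m. 0 < m \<Longrightarrow> m < d \<Longrightarrow> z ^ m \<noteq> 1"
    using assms(1) by (auto simp: primitive_roots_of_unity_def)
  have "z ^ m = z ^ (d * (m div d) + m mod d)"
    by simp
  also have "\<dots> = z ^ (m mod d)"
    unfolding power_add power_mult z(1) by simp
  finally have "z ^ (m mod d) = 1"
    using \<open>z ^ m = 1\<close> by simp
  then have "m mod d = 0"
    using z(2)[of "m mod d"] assms(2) by auto
  then show "d dvd m"
    by auto
next
  assume "d dvd m"
  then show "z ^ m = 1"
    using assms(1) by (auto simp: primitive_roots_of_unity_def power_mult)
qed

lemma primitive_roots_of_unityI:
  assumes "\<And>m. z ^ m = 1 \<longleftrightarrow> d dvd m"
  shows "z \<in> primitive_roots_of_unity d"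
  using assms by (auto simp: primitive_roots_of_unity_def dest: nat_dvd_not_less)

text \<open>An n-th root of unity is primitive of level d for d its order, which divides n.\<close>

lemma roots_of_unity_eq_UN:
  assumes "n > 0"
  shows "{z. z ^ n = 1} = (\<Union>d\<in>{d. d dvd n}. primitive_roots_of_unity d)"
proof (intro equalityI subsetI)
  fix z :: complex assume "z \<in> {z. z ^ n = 1}"
  define d where "d = (LEAST m. m > 0 \<and> z ^ m = 1)"
  have "d > 0 \<and> z ^ d = 1"
    unfolding d_def by (rule LeastI[of _ n]) (use \<open>z \<in> _\<close> assms in auto)
  moreover have "z ^ m \<noteq> 1" if "0 < m" "m < d" for m
    using that not_less_Least[of m "\<lambda>m. m > 0 \<and> z ^ m = 1"] by (auto simp: d_def)
  ultimately have "z \<in> primitive_roots_of_unity d" "d > 0"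
    by (auto simp: primitive_roots_of_unity_def)
  then show "z \<in> (\<Union>d\<in>{d. d dvd n}. primitive_roots_of_unity d)"
    using \<open>z \<in> {z. z ^ n = 1}\<close> primitive_root_power_eq_1_iff by blast
next
  fix z assume "z \<in> (\<Union>d\<in>{d. d dvd n}. primitive_roots_of_unity d)"
  then obtain d where "d dvd n" "z \<in> primitive_roots_of_unity d"
    by auto
  then show "z \<in> {z. z ^ n = 1}"
    using assms primitive_root_power_eq_1_iff[of z d n] dvd_pos_nat by auto
qed

lemma disjoint_primitive_roots_of_unity:
  assumes "d > 0" "d' > 0" "d \<noteq> d'"
  shows "primitive_roots_of_unity d \<inter> primitive_roots_of_unity d' = {}"
proof -
  have "d = d'" if "z \<in> primitive_roots_of_unity d" "z \<in> primitive_roots_of_unity d'" for z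
    using that assms(1,2) primitive_root_power_eq_1_iff dvd_antisym dvd_refl by metis
  with assms(3) show ?thesis
    by blast
qed

text \<open>The polynomial \<open>monom 1 n - 1\<close> is monic, and it is squarefree because its
  derivative vanishes at most at 0, which is not a root.\<close>

lemma prod_roots_of_unity:
  assumes "n > 0"
  shows "(\<Prod>z | z ^ n = 1. [:- z, 1:]) = monom 1 n - (1 :: complex poly)"
proof -
  let ?p = "monom 1 n - 1 :: complex poly"
  have "rsquarefree ?p"
    using assms by (auto simp: rsquarefree_roots poly_monom pderiv_diff pderiv_monom power_0_left)
  moreover have "lead_coeff ?p = 1"
  proof -
    have "degree ?p = n"
      using assms by (intro antisym degree_le le_degree) auto
    then show ?thesis
      using assms by simp
  qed
  ultimately show ?thesis
    using complex_poly_decompose_rsquarefree[of ?p] by (simp add: poly_monom)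
qed

lemma prod_cyclotomic_poly:
  assumes "n > 0"
  shows "(\<Prod>d | d dvd n. cyclotomic_poly d) = monom 1 n - 1"
proof -
  have pos: "d > 0" if "d dvd n" for d
    using that assms by (rule dvd_pos_nat[rotated])
  have "(\<Prod>d | d dvd n. cyclotomic_poly d)
      = (\<Prod>z\<in>(\<Union>d\<in>{d. d dvd n}. primitive_roots_of_unity d). [:- z, 1:])"
    unfolding cyclotomic_poly_def using assms pos
    by (intro prod.UNION_disjoint[symmetric])
      (auto simp: finite_primitive_roots_of_unity dest!: disjoint_primitive_roots_of_unity)
  then show ?thesis
    by (simp add: roots_of_unity_eq_UN[OF assms, symmetric] prod_roots_of_unity[OF assms])
qed

lemma primitive_roots_of_unity_1: "primitive_roots_of_unity (Suc 0) = {1}"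
  by (auto simp: primitive_roots_of_unity_def)

lemma cyclotomic_poly_1: "cyclotomic_poly (Suc 0) = [:-1, 1:]"
  by (simp add: cyclotomic_poly_def primitive_roots_of_unity_1)

lemma poly_cyclotomic_poly_1_eq_0_iff:
  assumes "d > 0"
  shows "poly (cyclotomic_poly d) 1 = 0 \<longleftrightarrow> d = 1"
proof -
  have "poly (cyclotomic_poly d) 1 = 0 \<longleftrightarrow> 1 \<in> primitive_roots_of_unity d"
    by (simp add: cyclotomic_poly_def poly_prod finite_primitive_roots_of_unity[OF assms])
  also have "\<dots> \<longleftrightarrow> d = 1"
  proof
    assume "1 \<in> primitive_roots_of_unity d"
    then show "d = 1"
      using primitive_root_power_eq_1_iff[of 1 d 1] assms by simp
  qed (simp add: primitive_roots_of_unity_1)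
  finally show ?thesis .
qed

section \<open>Cyclotomic polynomials under the substitution of -x for x\<close>

lemma alpha_scaled_eq:
  "alpha_scaled d = (if odd d then 2 * d else if \<not> 4 dvd d then d div 2 else d)"
proof -
  have "real (alpha_scaled d) = real (if odd d then 2 * d else if \<not> 4 dvd d then d div 2 else d)"
    by (auto simp: real_alpha_scaled alpha_def elim!: evenE)
  then show ?thesis
    by linarith
qed

lemma alpha_scaled_pos: "d > 0 \<Longrightarrow> alpha_scaled d > 0"
  by (auto simp: alpha_scaled_eq elim!: evenE)

text \<open>Odd numbers are swapped with their doubles, and multiples of 4 are fixed. The involution
  later yields one inclusion between sets of roots from the other.\<close>

lemma alpha_scaled_alpha_scaled: "alpha_scaled (alpha_scaled d) = d"
proof -
  have "4 dvd 2 * d \<longleftrightarrow> even d" for d :: nat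
    using nat_mult_dvd_cancel_disj[of 2 2 d] by simp
  then show ?thesis
    by (auto simp: alpha_scaled_eq elim!: evenE)
qed

text \<open>The condition (-z)^m = 1 says z^m = (-1)^m. For odd d no power of z is -1, and for even
  d one has -1 = z^(d/2), so the condition becomes one of parity and divisibility on m.\<close>

lemma uminus_in_primitive_roots_of_unity:
  assumes z: "z \<in> primitive_roots_of_unity d" and "d > 0"
  shows "- z \<in> primitive_roots_of_unity (alpha_scaled d)"
proof (rule primitive_roots_of_unityI)
  fix m
  note dvd_iff = primitive_root_power_eq_1_iff[OF z \<open>d > 0\<close>]
  have z1: "z ^ d = 1"
    using dvd_iff by simp
  show "(- z) ^ m = 1 \<longleftrightarrow> alpha_scaled d dvd m"
  proof (cases "odd d")
    case True
    \<comment> \<open>Raising z^m = -1 to the odd power d would give -1, whereas z^d = 1 forces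
      1.\<close>
    have "\<not> (odd m \<and> z ^ m = -1)"
    proof
      assume "odd m \<and> z ^ m = -1"
      then have "(z ^ m) ^ d = -1"
        using True by simp
      moreover have "(z ^ m) ^ d = 1"
        using z1 by (metis power_mult mult.commute power_one)
      ultimately show False
        by simp
    qed
    then have "(- z) ^ m = 1 \<longleftrightarrow> even m \<and> d dvd m"
      by (cases "even m") (auto simp: dvd_iff minus_equation_iff)
    also have "\<dots> \<longleftrightarrow> 2 * d dvd m"
      using True by (auto intro: divides_mult elim: dvd_mult_left dvd_mult_right)
    finally show ?thesis
      using True by (simp add: alpha_scaled_eq)
  next
    case False
    then obtain h where h: "d = 2 * h"
      by auto
    have "h > 0"
      using h \<open>d > 0\<close> by simp
    have zh: "z ^ h = -1"
    proof -
      have "(z ^ h)\<^sup>2 = 1"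
        using z1 by (simp add: h power_mult[symmetric] mult.commute)
      moreover have "z ^ h \<noteq> 1"
        using dvd_iff[of h] \<open>h > 0\<close> by (auto simp: h dest: dvd_imp_le)
      ultimately show ?thesis
        by (simp add: power2_eq_1_iff)
    qed
    \<comment> \<open>For odd m the equation is z^m = -1; multiplying by z^h = -1 turns it into
      z^(m+h) = 1.\<close>
    have "(- z) ^ m = 1 \<longleftrightarrow> (if even m then d dvd m else d dvd m + h)"
      by (auto simp: dvd_iff[symmetric] power_add zh minus_equation_iff)
    moreover have "2 * h dvd m + h \<longleftrightarrow> odd h \<and> h dvd m" if "odd m"
    proof
      assume *: "2 * h dvd m + h"
      then have "even (m + h)" "h dvd m + h"
        using dvd_mult_left[OF *] dvd_mult_right[OF *] by blast+
      then show "odd h \<and> h dvd m"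
        using that by auto
    next
      assume "odd h \<and> h dvd m"
      then show "2 * h dvd m + h"
        using that by (intro divides_mult) auto
    qed
    moreover have "d dvd m \<longleftrightarrow> h dvd m" if "even m" "odd h"
      using that by (auto simp: h intro: divides_mult elim: dvd_mult_left dvd_mult_right)
    moreover have "\<not> d dvd m" if "odd m"
      using that by (auto simp: h elim: dvd_mult_left)
    moreover have "4 dvd d \<longleftrightarrow> even h"
      using nat_mult_dvd_cancel_disj[of 2 2 h] by (simp add: h)
    ultimately show ?thesis
      using False by (auto simp: alpha_scaled_eq h)
  qed
qed

lemma primitive_roots_of_unity_alpha_scaled:
  assumes "d > 0"
  shows "primitive_roots_of_unity (alpha_scaled d) = uminus ` primitive_roots_of_unity d"
proof (intro equalityI subsetI)
  fix z assume "z \<in> primitive_roots_of_unity (alpha_scaled d)"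
  then have "- z \<in> primitive_roots_of_unity d"
    using uminus_in_primitive_roots_of_unity[of z "alpha_scaled d"] assms
    by (simp add: alpha_scaled_pos alpha_scaled_alpha_scaled)
  then show "z \<in> uminus ` primitive_roots_of_unity d"
    by force
qed (use assms in \<open>auto intro: uminus_in_primitive_roots_of_unity\<close>)

text \<open>Each linear factor satisfies -x - z = -(x - (-z)), and -z runs through the primitive
  roots of level \<open>alpha_scaled d\<close>; every root contributes one sign.\<close>

lemma poly_cyclotomic_poly_uminus:
  assumes "d > 0"
  shows "poly (cyclotomic_poly d) (- x)
    = (-1) ^ card (primitive_roots_of_unity d) * poly (cyclotomic_poly (alpha_scaled d)) x"
proof -
  have "(-1) ^ card (primitive_roots_of_unity d) * poly (cyclotomic_poly (alpha_scaled d)) x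
      = (\<Prod>z\<in>primitive_roots_of_unity d. -1) * (\<Prod>z\<in>primitive_roots_of_unity d. x + z)"
    by (simp add: cyclotomic_poly_def poly_prod prod.reindex
        primitive_roots_of_unity_alpha_scaled[OF assms] add.commute)
  also have "\<dots> = poly (cyclotomic_poly d) (- x)"
    unfolding prod.distrib[symmetric]
    by (simp add: cyclotomic_poly_def poly_prod algebra_simps)
  finally show ?thesis ..
qed


section \<open>Logarithmic derivatives in the exponential variable\<close>

text \<open>
  The Stirling numbers are the coefficients of the powers of the Euler operator \<open>u d/du\<close>, which
  becomes \<open>d/dt\<close> under \<open>u = c e\<^sup>t\<close>.
\<close>
lemma higher_deriv_compose_exp:
  assumes S: "open S" "h holomorphic_on S" and "c * exp t \<in> S"
  shows "(deriv ^^ m) (\<lambda>t. c * exp t * h (c * exp t)) t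
    = (\<Sum>j=1..Suc m. of_nat (Stirling (Suc m) j) * (c * exp t) ^ j * (deriv ^^ (j - 1)) h (c * exp t))"
  using assms(3)
proof (induction m arbitrary: t)
  case (Suc m)
  define T where "T = {t. c * exp t \<in> S}"
  \<comment> \<open>The product rule gives H_j' = j H_j + H_(j+1), which mirrors the Stirling
    recurrence.\<close>
  define H where "H = (\<lambda>j t. (c * exp t) ^ j * (deriv ^^ (j - 1)) h (c * exp t))"
  have "open ((\<lambda>t. c * exp t) -` S)"
    by (intro open_vimage S continuous_intros)
  then have "open T"
    by (simp add: T_def vimage_def)
  have H_deriv: "(H j has_field_derivative of_nat j * H j t + H (Suc j) t) (at t)"
    if "j > 0" for j
  proof -
    have "((deriv ^^ (j - 1)) h has_field_derivative (deriv ^^ j) h (c * exp t)) (at (c * exp t))"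
      using has_field_derivative_higher_deriv[OF S(2,1) Suc.prems, of "j - 1"] that by simp
    then have outer: "((\<lambda>t. (deriv ^^ (j - 1)) h (c * exp t)) has_field_derivative
        (deriv ^^ j) h (c * exp t) * (c * exp t)) (at t)"
      by (rule DERIV_chain2) (auto intro!: derivative_eq_intros)
    have "((\<lambda>t. (c * exp t) ^ j) has_field_derivative of_nat j * (c * exp t) ^ j) (at t)"
    proof -
      have "((\<lambda>t. c * exp t) has_field_derivative c * exp t) (at t)"
        by (auto intro!: derivative_eq_intros)
      from DERIV_power[OF this, of j] show ?thesis
        using that by (cases j) simp_all
    qed
    from DERIV_mult[OF this outer] show ?thesis
      by (simp add: H_def algebra_simps)
  qed
  have "(deriv ^^ Suc m) (\<lambda>t. c * exp t * h (c * exp t)) t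
      = deriv (\<lambda>t. \<Sum>j=1..Suc m. of_nat (Stirling (Suc m) j) * H j t) t"
  proof -
    \<comment> \<open>To be differentiated, the induction hypothesis must hold in a neighbourhood of
      \<open>t\<close>, not only at \<open>t\<close>.\<close>
    have "eventually (\<lambda>t. t \<in> T) (nhds t)"
      using \<open>open T\<close> Suc.prems by (intro eventually_nhds_in_open) (auto simp: T_def)
    then have "eventually (\<lambda>t. (deriv ^^ m) (\<lambda>t. c * exp t * h (c * exp t)) t
        = (\<Sum>j=1..Suc m. of_nat (Stirling (Suc m) j) * H j t)) (nhds t)"
      by eventually_elim (use Suc.IH in \<open>simp only: T_def H_def mult.assoc mem_Collect_eq\<close>)
    then show ?thesis
      by (simp add: deriv_cong_ev del: sum.cl_ivl_Suc)
  qed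
  also have "\<dots> = (\<Sum>j=1..Suc m. of_nat (Stirling (Suc m) j) * (of_nat j * H j t + H (Suc j) t))"
    by (intro DERIV_imp_deriv DERIV_sum DERIV_cmult H_deriv) auto
  also have "\<dots> = (\<Sum>j=1..Suc m. of_nat (j * Stirling (Suc m) j) * H j t)
      + (\<Sum>j=1..Suc m. of_nat (Stirling (Suc m) j) * H (Suc j) t)"
    by (simp add: sum.distrib algebra_simps del: sum.cl_ivl_Suc)
  also have "(\<Sum>j=1..Suc m. of_nat (Stirling (Suc m) j) * H (Suc j) t)
      = (\<Sum>j=2..Suc (Suc m). of_nat (Stirling (Suc m) (j - 1)) * H j t)"
    by (rule sum.reindex_bij_witness[of _ "\<lambda>j. j - 1" Suc]) auto
  \<comment> \<open>The new term j = 1 is zero since \<open>Stirling (Suc m) 0 = 0\<close>; in the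
    other sum, the new top term is zero since its index exceeds \<open>Suc m\<close>.\<close>
  also have "\<dots> = (\<Sum>j=1..Suc (Suc m). of_nat (Stirling (Suc m) (j - 1)) * H j t)"
    by (rule sum.mono_neutral_left) (auto simp: not_le numeral_2_eq_2 less_Suc_eq)
  also have "(\<Sum>j=1..Suc m. of_nat (j * Stirling (Suc m) j) * H j t)
      = (\<Sum>j=1..Suc (Suc m). of_nat (j * Stirling (Suc m) j) * H j t)"
    by simp
  also have "\<dots> + (\<Sum>j=1..Suc (Suc m). of_nat (Stirling (Suc m) (j - 1)) * H j t)
      = (\<Sum>j=1..Suc (Suc m). of_nat (Stirling (Suc (Suc m)) j) * H j t)"
    unfolding sum.distrib[symmetric]
  proof (intro sum.cong refl)
    fix j assume "j \<in> {1..Suc (Suc m)}"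
    then obtain i where "j = Suc i"
      by (cases j) auto
    then show "of_nat (j * Stirling (Suc m) j) * H j t + of_nat (Stirling (Suc m) (j - 1)) * H j t
        = of_nat (Stirling (Suc (Suc m)) j) * H j t"
      by (simp add: algebra_simps)
  qed
  finally show ?case
    by (simp add: H_def mult.assoc del: sum.cl_ivl_Suc)
qed (use assms in simp)

section \<open>Logarithmic derivatives of formal power series\<close>

lemma fps_prod_nth_0: "fps_nth (\<Prod>x\<in>A. F x) 0 = (\<Prod>x\<in>A. fps_nth (F x) 0)"
  for F :: "_ \<Rightarrow> 'a::comm_ring_1 fps"
  by (induction A rule: infinite_finite_induct) simp_all

text \<open>For a zero constant term \<open>inverse F\<close> is 0 by convention, hence the
  nonvanishing hypotheses in the rules below.\<close>

definition fps_log_deriv :: "complex fps \<Rightarrow> complex fps" where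
  "fps_log_deriv F = fps_deriv F * inverse F"

lemma fps_log_deriv_mult:
  assumes "fps_nth F 0 \<noteq> 0" "fps_nth G 0 \<noteq> 0"
  shows "fps_log_deriv (F * G) = fps_log_deriv F + fps_log_deriv G"
proof -
  have "F * inverse F = 1" "G * inverse G = 1"
    using assms by (simp_all add: inverse_mult_eq_1')
  then show ?thesis
    unfolding fps_log_deriv_def fps_inverse_mult fps_deriv_mult by algebra
qed

lemma fps_log_deriv_1 [simp]: "fps_log_deriv 1 = 0"
  by (simp add: fps_log_deriv_def)

lemma fps_log_deriv_const [simp]: "fps_log_deriv (fps_const a) = 0"
  by (simp add: fps_log_deriv_def)

lemma fps_log_deriv_power:
  assumes "fps_nth F 0 \<noteq> 0"
  shows "fps_log_deriv (F ^ n) = of_nat n * fps_log_deriv F"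
  using assms by (induction n) (simp_all add: fps_log_deriv_mult fps_nth_power_0 algebra_simps)

lemma fps_log_deriv_prod:
  assumes "\<And>x. x \<in> A \<Longrightarrow> fps_nth (F x) 0 \<noteq> 0"
  shows "fps_log_deriv (\<Prod>x\<in>A. F x) = (\<Sum>x\<in>A. fps_log_deriv (F x))"
  using assms
  by (induction A rule: infinite_finite_induct) (simp_all add: fps_log_deriv_mult fps_prod_nth_0)

section \<open>Polynomials expanded in t along u = c e^t\<close>

definition exp_fps :: "complex \<Rightarrow> complex poly \<Rightarrow> complex fps" where
  "exp_fps c p = fps_expansion (\<lambda>t. poly p (c * exp t)) 0"

lemma has_fps_expansion_exp_fps: "(\<lambda>t. poly p (c * exp t)) has_fps_expansion exp_fps c p"
  unfolding exp_fps_def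
  by (intro analytic_at_imp_has_fps_expansion_0 holomorphic_on_imp_analytic_at[of _ UNIV]
      holomorphic_intros) auto

lemma exp_fps_eqI: "(\<lambda>t. poly p (c * exp t)) has_fps_expansion F \<Longrightarrow> exp_fps c p = F"
  using has_fps_expansion_exp_fps fps_expansion_unique_complex by blast

text \<open>This turns nonvanishing of a polynomial at \<open>c\<close> into invertibility of its
  series.\<close>

lemma exp_fps_nth_0 [simp]: "fps_nth (exp_fps c p) 0 = poly p c"
  by (simp add: exp_fps_def fps_expansion_def)

lemma exp_fps_mult: "exp_fps c (p * q) = exp_fps c p * exp_fps c q"
  by (rule exp_fps_eqI) (simp add: has_fps_expansion_mult has_fps_expansion_exp_fps)

lemma exp_fps_1: "exp_fps c 1 = 1"
  by (rule exp_fps_eqI) simp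

lemma exp_fps_power: "exp_fps c (p ^ n) = exp_fps c p ^ n"
  by (induction n) (simp_all add: exp_fps_mult exp_fps_1)

lemma exp_fps_prod: "exp_fps c (\<Prod>x\<in>A. p x) = (\<Prod>x\<in>A. exp_fps c (p x))"
  by (induction A rule: infinite_finite_induct) (simp_all add: exp_fps_mult exp_fps_1)

lemma exp_fps_monom: "exp_fps c (monom 1 n) = fps_const (c ^ n) * fps_exp (of_nat n)"
proof (rule exp_fps_eqI)
  have "(\<lambda>t. c ^ n * exp (of_nat n * t)) has_fps_expansion fps_const (c ^ n) * fps_exp (of_nat n)"
    by (intro fps_expansion_intros)
  then show "(\<lambda>t. poly (monom 1 n) (c * exp t)) has_fps_expansion fps_const (c ^ n) * fps_exp (of_nat n)"
    by (simp add: poly_monom power_mult_distrib exp_of_nat_mult)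
qed

lemma exp_fps_monom_minus_1: "exp_fps 1 (monom 1 n - 1) = fps_exp (of_nat n) - 1"
proof (rule exp_fps_eqI)
  have "(\<lambda>t. exp (of_nat n * t) - 1) has_fps_expansion fps_exp (of_nat n) - (1 :: complex fps)"
    by (intro fps_expansion_intros)
  then show "(\<lambda>t. poly (monom 1 n - 1) (1 * exp t :: complex)) has_fps_expansion fps_exp (of_nat n) - 1"
    by (simp add: poly_monom exp_of_nat_mult poly_diff)
qed

text \<open>Bridge from iterated derivatives to formal series. With u = c e^t and h = p'/p, the
  chain rule gives u h(u) as the logarithmic derivative of p(c e^t) in t. Its derivative of order k
  - 1 at t = 0 is the Stirling sum on one side and a Taylor coefficient times (k - 1)! on the
  other.\<close>

lemma sum_Stirling_log_deriv:
  assumes "poly p c \<noteq> 0" "k \<ge> 1"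
  shows "(\<Sum>j=1..k. of_nat (Stirling k j) * c ^ j * log_deriv (poly p) j c)
    = fact (k - 1) * fps_nth (fps_log_deriv (exp_fps c p)) (k - 1)"
proof -
  define h where "h = (\<lambda>w. deriv (poly p) w / poly p w)"
  define S where "S = {w. poly p w \<noteq> 0}"
  have "open S"
    unfolding S_def by (intro open_Collect_neq continuous_intros)
  have "h holomorphic_on S"
    unfolding h_def using \<open>open S\<close> by (intro holomorphic_intros) (auto simp: S_def)
  have deriv_exp: "deriv (\<lambda>t. poly p (c * exp t)) t = c * exp t * deriv (poly p) (c * exp t)" for t
  proof -
    have "((\<lambda>t. poly p (c * exp t)) has_field_derivative poly (pderiv p) (c * exp t) * (c * exp t)) (at t)"
      by (rule DERIV_chain2[OF poly_DERIV]) (auto intro!: derivative_eq_intros)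
    moreover have "deriv (poly p) (c * exp t) = poly (pderiv p) (c * exp t)"
      by (intro DERIV_imp_deriv poly_DERIV)
    ultimately show ?thesis
      by (metis DERIV_imp_deriv mult.commute)
  qed
  have "(\<lambda>t. deriv (\<lambda>t. poly p (c * exp t)) t / poly p (c * exp t))
      has_fps_expansion fps_deriv (exp_fps c p) / exp_fps c p"
    using assms(1)
    by (intro has_fps_expansion_divide' has_fps_expansion_deriv has_fps_expansion_exp_fps) simp
  then have "(\<lambda>t. c * exp t * h (c * exp t)) has_fps_expansion fps_log_deriv (exp_fps c p)"
    using assms(1) by (simp add: deriv_exp h_def fps_log_deriv_def fps_divide_unit)
  then have "fact (k - 1) * fps_nth (fps_log_deriv (exp_fps c p)) (k - 1)
      = (deriv ^^ (k - 1)) (\<lambda>t. c * exp t * h (c * exp t)) 0"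
    by (simp add: fps_nth_fps_expansion)
  also have "\<dots> = (\<Sum>j=1..k. of_nat (Stirling k j) * c ^ j * (deriv ^^ (j - 1)) h c)"
    using higher_deriv_compose_exp[OF \<open>open S\<close> \<open>h holomorphic_on S\<close>, of c 0 "k - 1"] assms
    by (simp add: S_def)
  finally show ?thesis
    by (simp add: log_deriv_def h_def)
qed


section \<open>Bernoulli numbers\<close>

text \<open>For nonzero a this is the series of a t e^(a t) / (e^(a t) - 1). Giving the coefficients
  avoids dividing by a series without constant term.\<close>

definition bernoulli_fps :: "complex \<Rightarrow> complex fps" where
  "bernoulli_fps a = Abs_fps (\<lambda>k. a ^ k * of_real (bernoulli_plus k) / fact k)"

lemma bernoulli_fps_mult:
  "bernoulli_fps a * (fps_exp a - 1) = fps_const a * fps_X * fps_exp a"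
proof -
  have "bernoulli_fps 1 * (fps_exp 1 - 1) = fps_X * fps_exp 1"
  proof (rule fps_ext)
    fix n
    have "fps_nth (bernoulli_fps 1 * (fps_exp 1 - 1)) n
       = of_real (fps_nth (Abs_fps (\<lambda>k. bernoulli_plus k / fact k) * (fps_exp 1 - 1)) n)"
      unfolding fps_mult_nth of_real_sum by (intro sum.cong refl) (simp add: bernoulli_fps_def)
    also have "\<dots> = fps_nth (fps_X * fps_exp 1) n"
      by (simp add: bernoulli_plus_gen_fun)
    finally show "fps_nth (bernoulli_fps 1 * (fps_exp 1 - 1)) n = fps_nth (fps_X * fps_exp 1) n" .
  qed
  \<comment> \<open>The general identity follows from the case a = 1 by substituting a t for
    t.\<close>
  then have "(bernoulli_fps 1 * (fps_exp 1 - 1)) oo (fps_const a * fps_X)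
      = (fps_X * fps_exp 1) oo (fps_const a * fps_X)"
    by simp
  moreover have "bernoulli_fps 1 oo (fps_const a * fps_X) = bernoulli_fps a"
    by (simp add: fps_compose_linear bernoulli_fps_def)
  ultimately show ?thesis
    by (simp add: fps_compose_mult_distrib fps_compose_sub_distrib)
qed

text \<open>For F = (e^(a t) - 1) / (e^t - 1), F'/F is the difference of a e^(a t) / (e^(a t) - 1)
  and e^t / (e^t - 1). For nonzero a each has a simple pole at 0; the factor \<open>fps_X\<close>
  clears it and produces the two Bernoulli series.\<close>

lemma X_times_fps_log_deriv_quotient:
  assumes "F * (fps_exp 1 - 1) = fps_exp a - 1" "fps_nth F 0 \<noteq> 0"
  shows "fps_X * fps_log_deriv F = bernoulli_fps a - bernoulli_fps 1"
proof -
  let ?E = "fps_exp 1 - 1 :: complex fps"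
  have "?E \<noteq> 0"
  proof
    assume "?E = 0"
    then have "fps_nth ?E 1 = 0"
      by (metis fps_zero_nth)
    then show False
      by simp
  qed
  have "fps_deriv (F * ?E) = fps_deriv (fps_exp a - 1)"
    using assms(1) by simp
  then have deriv: "fps_deriv F * ?E + F * fps_exp 1 = fps_const a * fps_exp a"
    by (simp add: add.commute)
  \<comment> \<open>\<open>?E\<close> has constant term 0 and so no inverse; the identity is proved
    multiplied by \<open>?E\<close>, which is then cancelled as a nonzero element of an integral
    domain.\<close>
  have "(fps_X * fps_deriv F) * ?E = fps_X * (fps_const a * fps_exp a) - F * (fps_X * fps_exp 1)"
    by (simp flip: deriv add: algebra_simps)
  also have "\<dots> = bernoulli_fps a * (F * ?E) - F * (bernoulli_fps 1 * ?E)"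
    using bernoulli_fps_mult[of a] bernoulli_fps_mult[of 1] assms(1) by (simp add: mult_ac)
  also have "\<dots> = ((bernoulli_fps a - bernoulli_fps 1) * F) * ?E"
    by (simp add: algebra_simps)
  finally have "fps_X * fps_deriv F = (bernoulli_fps a - bernoulli_fps 1) * F"
    using \<open>?E \<noteq> 0\<close> mult_right_cancel by blast
  then have "fps_X * fps_deriv F * inverse F = (bernoulli_fps a - bernoulli_fps 1) * (F * inverse F)"
    by (simp add: mult.assoc)
  then show ?thesis
    using assms(2) by (simp add: fps_log_deriv_def inverse_mult_eq_1' mult.assoc)
qed


section \<open>The logarithmic derivative of a cyclotomic polynomial\<close>

text \<open>Summed over the divisors d > 1 of n, both sides give b (n^k - 1). By strong induction
  they agree at every such d < n, so they agree at n.\<close>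

lemma fps_log_deriv_cyclotomic_poly_nth:
  assumes "d > 1" "k \<ge> 1"
  shows "fps_nth (fps_log_deriv (exp_fps 1 (cyclotomic_poly d))) (k - 1)
    = of_real (bernoulli_plus k / fact k * jordan_totient k d)"
  using assms(1)
proof (induction d rule: less_induct)
  case (less n)
  define L where "L = (\<lambda>d. fps_log_deriv (exp_fps 1 (cyclotomic_poly d)))"
  define b :: complex where "b = of_real (bernoulli_plus k / fact k)"
  \<comment> \<open>The divisor 1 is left out because the first cyclotomic polynomial vanishes at 1,
    so its series is not invertible.\<close>
  define A where "A = {d. d dvd n \<and> d \<noteq> 1}"
  have pos: "d > 0" if "d dvd n" for d
    using that less.prems by (intro dvd_pos_nat[of n d]) auto
  have div: "finite A" "{d. d dvd n} = insert 1 A" "1 \<notin> A"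
    using less.prems by (auto simp: A_def)
  have nz: "poly (cyclotomic_poly d) 1 \<noteq> 0" if "d \<in> A" for d
    using that pos by (auto simp: A_def poly_cyclotomic_poly_1_eq_0_iff)
  define F where "F = exp_fps 1 (\<Prod>d\<in>A. cyclotomic_poly d)"
  have "monom 1 n - 1 = (\<Prod>d\<in>A. cyclotomic_poly d) * (monom 1 1 - 1)"
    using prod_cyclotomic_poly[of n] prod_cyclotomic_poly[of 1] div less.prems
    by (simp add: mult.commute)
  then have "F * (fps_exp 1 - 1) = fps_exp (of_nat n) - 1"
    using exp_fps_monom_minus_1[of n] exp_fps_monom_minus_1[of 1] by (simp add: F_def exp_fps_mult)
  moreover have "fps_nth F 0 \<noteq> 0"
    using nz div(1) by (simp add: F_def poly_prod)
  ultimately have "fps_X * fps_log_deriv F = bernoulli_fps (of_nat n) - bernoulli_fps 1"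
    by (rule X_times_fps_log_deriv_quotient)
  \<comment> \<open>Multiplication by \<open>fps_X\<close> shifts the coefficient of index k - 1 to
    index k.\<close>
  then have "fps_nth (fps_X * fps_log_deriv F) k = b * (of_nat n ^ k - 1)"
    by (simp only: bernoulli_fps_def b_def) (simp add: field_simps)
  moreover have "fps_log_deriv F = (\<Sum>d\<in>A. L d)"
    using nz by (simp add: F_def exp_fps_prod fps_log_deriv_prod L_def)
  ultimately have "(\<Sum>d\<in>A. fps_nth (L d) (k - 1)) = b * (of_nat n ^ k - 1)"
    using assms(2) by (simp add: fps_sum_nth)
  moreover have "(\<Sum>d\<in>A. jordan_totient k d) = real n ^ k - 1"
    using sum_jordan_totient[of n k] less.prems div by simp
  then have "(\<Sum>d\<in>A. b * of_real (jordan_totient k d)) = b * (of_nat n ^ k - 1)"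
    by (simp flip: sum_distrib_left of_real_sum)
  moreover have "fps_nth (L d) (k - 1) = b * of_real (jordan_totient k d)" if "d \<in> A - {n}" for d
  proof -
    have "d > 1" "d < n"
      using that pos[of d] less.prems dvd_imp_le[of d n] by (auto simp: A_def)
    then show ?thesis
      using less.IH[of d] by (simp add: L_def b_def)
  qed
  moreover have "n \<in> A"
    using less.prems by (simp add: A_def)
  ultimately have "fps_nth (L n) (k - 1) = b * of_real (jordan_totient k n)"
    using sum.remove[OF div(1) \<open>n \<in> A\<close>, of "\<lambda>d. fps_nth (L d) (k - 1)"]
      sum.remove[OF div(1) \<open>n \<in> A\<close>, of "\<lambda>d. b * of_real (jordan_totient k d)"]
      sum.cong[of "A - {n}" "A - {n}" "\<lambda>d. fps_nth (L d) (k - 1)" "\<lambda>d. b * of_real (jordan_totient k d)"]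
    by simp
  then show ?case
    by (simp add: L_def b_def)
qed

lemma exp_fps_cyclotomic_poly_uminus:
  assumes "d > 0"
  shows "exp_fps (-1) (cyclotomic_poly d)
    = fps_const ((-1) ^ card (primitive_roots_of_unity d)) * exp_fps 1 (cyclotomic_poly (alpha_scaled d))"
proof (rule exp_fps_eqI)
  show "(\<lambda>t. poly (cyclotomic_poly d) (-1 * exp t)) has_fps_expansion
      fps_const ((-1) ^ card (primitive_roots_of_unity d)) * exp_fps 1 (cyclotomic_poly (alpha_scaled d))"
    using has_fps_expansion_cmult_left[OF has_fps_expansion_exp_fps[of "cyclotomic_poly (alpha_scaled d)" 1]]
    by (simp add: poly_cyclotomic_poly_uminus[OF assms])
qed

text \<open>The logarithmic derivative does not see the constant sign. Nonvanishing at -1 becomes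
  nonvanishing at 1 for the index \<open>alpha_scaled d\<close>, which excludes the value 1.\<close>

lemma fps_log_deriv_cyclotomic_poly_uminus:
  assumes "d > 0" "poly (cyclotomic_poly d) (-1) \<noteq> 0"
  shows "alpha_scaled d > 1"
    and "fps_log_deriv (exp_fps (-1) (cyclotomic_poly d))
      = fps_log_deriv (exp_fps 1 (cyclotomic_poly (alpha_scaled d)))"
proof -
  have nz: "poly (cyclotomic_poly (alpha_scaled d)) 1 \<noteq> 0"
    using assms poly_cyclotomic_poly_uminus[of d 1] by auto
  then show "alpha_scaled d > 1"
    using poly_cyclotomic_poly_1_eq_0_iff[of "alpha_scaled d"] alpha_scaled_pos[OF assms(1)] by simp
  show "fps_log_deriv (exp_fps (-1) (cyclotomic_poly d))
      = fps_log_deriv (exp_fps 1 (cyclotomic_poly (alpha_scaled d)))"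
    using nz by (simp add: exp_fps_cyclotomic_poly_uminus[OF assms(1)] fps_log_deriv_mult)
qed

text \<open>Serves both evaluations: \<alpha> is the identity for c = 1 and
  \<open>alpha_scaled\<close> for c = -1.\<close>

lemma sum_Stirling_log_deriv_cyclotomic_prod:
  fixes \<alpha> :: "nat \<Rightarrow> nat"
  assumes f: "f = monom 1 e0 * (\<Prod>d\<in>D. cyclotomic_poly d ^ e d)"
    and D: "finite D" "\<And>d. d \<in> D \<Longrightarrow> e d \<ge> 1"
    and nz: "poly f c \<noteq> 0" and "k \<ge> 2"
    and \<alpha>: "\<And>d. d \<in> D \<Longrightarrow> poly (cyclotomic_poly d) c \<noteq> 0 \<Longrightarrow> \<alpha> d > 1 \<and>
      fps_log_deriv (exp_fps c (cyclotomic_poly d)) = fps_log_deriv (exp_fps 1 (cyclotomic_poly (\<alpha> d)))"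
  shows "(\<Sum>j=1..k. of_nat (Stirling k j) * c ^ j * log_deriv (poly f) j c)
    = of_real (bernoulli_plus k / real k * (\<Sum>d\<in>D. real (e d) * jordan_totient k (\<alpha> d)))"
proof -
  \<comment> \<open>As e d is positive, a root of a factor would be a root of f.\<close>
  have nzd: "poly (cyclotomic_poly d) c \<noteq> 0" if "d \<in> D" for d
    using nz D that by (force simp: f poly_prod)
  have "poly (monom 1 e0) c \<noteq> 0"
    using nz by (simp add: f)
  then have c: "c ^ e0 \<noteq> 0"
    by (simp add: poly_monom)
  have nth_prod: "fps_nth (\<Prod>d\<in>D. exp_fps c (cyclotomic_poly d) ^ e d) 0 \<noteq> 0"
    using nzd D(1) by (simp add: fps_prod_nth_0 fps_nth_power_0)
  have "fps_log_deriv (exp_fps c f) = fps_log_deriv (fps_exp (of_nat e0))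
      + (\<Sum>d\<in>D. of_nat (e d) * fps_log_deriv (exp_fps c (cyclotomic_poly d)))"
    using c nzd nth_prod
    by (simp add: f exp_fps_mult exp_fps_monom exp_fps_prod exp_fps_power fps_log_deriv_mult
        fps_log_deriv_prod fps_log_deriv_power fps_nth_power_0)
  \<comment> \<open>The power of x contributes only to the coefficient of index 0, and k >= 2 puts
    the index k - 1 beyond it.\<close>
  also have "fps_log_deriv (fps_exp (of_nat e0)) = fps_const (of_nat e0)"
    by (simp add: fps_log_deriv_def mult.assoc inverse_mult_eq_1')
  also have "(\<Sum>d\<in>D. of_nat (e d) * fps_log_deriv (exp_fps c (cyclotomic_poly d)))
      = (\<Sum>d\<in>D. of_nat (e d) * fps_log_deriv (exp_fps 1 (cyclotomic_poly (\<alpha> d))))"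
    using \<alpha> nzd by (intro sum.cong) auto
  finally have "fps_nth (fps_log_deriv (exp_fps c f)) (k - 1)
      = (\<Sum>d\<in>D. of_nat (e d) * of_real (bernoulli_plus k / fact k * jordan_totient k (\<alpha> d)))"
    using \<open>k \<ge> 2\<close> \<alpha> nzd
    by (simp add: fps_sum_nth fps_of_nat[symmetric]
        fps_log_deriv_cyclotomic_poly_nth[unfolded One_nat_def])
  also have "\<dots> = of_real (bernoulli_plus k / fact k * (\<Sum>d\<in>D. real (e d) * jordan_totient k (\<alpha> d)))"
    by (simp add: sum_distrib_left mult_ac)
  finally have "fact (k - 1) * fps_nth (fps_log_deriv (exp_fps c f)) (k - 1)
      = of_real (fact (k - 1) * (bernoulli_plus k / fact k)
        * (\<Sum>d\<in>D. real (e d) * jordan_totient k (\<alpha> d)))"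
    by simp
  also have "fact (k - 1) * (bernoulli_plus k / fact k) = bernoulli_plus k / real k"
    using \<open>k \<ge> 2\<close> by (simp add: fact_reduce[of k])
  finally show ?thesis
    using sum_Stirling_log_deriv[OF nz, of k] \<open>k \<ge> 2\<close> by simp
qed

theorem theorem5p8:
  fixes e0 :: nat and D :: "nat set" and e :: "nat \<Rightarrow> nat" and f :: "complex poly"
  assumes "finite D"
    and "\<And>d. d \<in> D \<Longrightarrow> d \<ge> 1"
    and "\<And>d. d \<in> D \<Longrightarrow> e d \<ge> 1"
    and "f = monom 1 e0 * (\<Prod>d\<in>D. cyclotomic_poly d ^ e d)"
  shows "(poly f 1 \<noteq> 0 \<longrightarrow> (\<forall>k\<ge>2.
            (\<Sum>j=1..k. of_nat (Stirling k j) * log_deriv (poly f) j 1)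
              = complex_of_real (bernoulli_plus k / real k
                  * (\<Sum>d\<in>D. real (e d) * jordan_totient k d)))) \<and>
         (poly f (-1) \<noteq> 0 \<longrightarrow> (\<forall>k\<ge>2.
            (\<Sum>j=1..k. (-1) ^ j * of_nat (Stirling k j) * log_deriv (poly f) j (-1))
              = complex_of_real (bernoulli_plus k / real k
                  * (\<Sum>d\<in>D. real (e d) * jordan_totient k (alpha_scaled d)))))"
proof (intro conjI impI allI)
  fix k :: nat
  assume "poly f 1 \<noteq> 0" "k \<ge> 2"
  \<comment> \<open>The index d = 1 is ruled out since its polynomial x - 1 vanishes at 1.\<close>
  have "d > 1" if "d \<in> D" "poly (cyclotomic_poly d) 1 \<noteq> 0" for d
    using that assms(2)[of d] by (cases "d = 1") (auto simp: cyclotomic_poly_1)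
  then show "(\<Sum>j=1..k. of_nat (Stirling k j) * log_deriv (poly f) j 1)
      = complex_of_real (bernoulli_plus k / real k * (\<Sum>d\<in>D. real (e d) * jordan_totient k d))"
    using sum_Stirling_log_deriv_cyclotomic_prod[where \<alpha> = "\<lambda>d. d", OF assms(4,1,3) \<open>poly f 1 \<noteq> 0\<close> \<open>k \<ge> 2\<close>]
    by simp
next
  fix k :: nat
  assume "poly f (-1) \<noteq> 0" "k \<ge> 2"
  have "alpha_scaled d > 1 \<and> fps_log_deriv (exp_fps (-1) (cyclotomic_poly d))
      = fps_log_deriv (exp_fps 1 (cyclotomic_poly (alpha_scaled d)))"
    if "d \<in> D" "poly (cyclotomic_poly d) (-1) \<noteq> 0" for d
    using that assms(2)[of d] fps_log_deriv_cyclotomic_poly_uminus[of d] by auto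
  then show "(\<Sum>j=1..k. (-1) ^ j * of_nat (Stirling k j) * log_deriv (poly f) j (-1))
      = complex_of_real (bernoulli_plus k / real k
          * (\<Sum>d\<in>D. real (e d) * jordan_totient k (alpha_scaled d)))"
    using sum_Stirling_log_deriv_cyclotomic_prod[where \<alpha> = alpha_scaled, OF assms(4,1,3) \<open>poly f (-1) \<noteq> 0\<close> \<open>k \<ge> 2\<close>]
    by (simp add: mult.commute mult.left_commute)
qed

end
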